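(* Let $(A,\ast,\alpha)$ be a Hom-Novikov superalgebra over a field $\mathbf{F}$, and let $g_t(x,y)=\sum_{i\ge 0}G_i(x,y)t^i$ and $g_t'(x,y)=\sum_{i\ge 0}G_i'(x,y)t^i$ be equivalent 1-parameter formal deformations of $(A,\ast,\alpha)$. Then $G_1$ and $G_1'$ belong to the same cohomology class in $H^2_\alpha(A,A)$.
   Context: $\mathbf{F}$ is an arbitrary field. All graded spaces are $\mathbb{Z}_2$-graded, $A=A_{\bar 0}\oplus A_{\bar 1}$, $|x|$ is the degree of a homogeneous element $x$, and identities involving signs are for homogeneous elements. Hom-Novikov superalgebra: a triple $(A,\ast,\alpha)$, where $A$ is a $\mathbb{Z}_2$-graded vector space, $\ast$ is an even bilinear product (degrees add) and $\alpha:A\to A$ is an even (degree-preserving) linear map, such that for all homogeneous $x,y,z$: (1) $\alpha(x\ast y)=\alpha(x)\ast\alpha(y)$; (2) $(x\ast y)\ast\alpha(z)-\alpha(x)\ast(y\ast z)=(-1)^{|x||y|}\big((y\ast x)\ast\alpha(z)-\alpha(y)\ast(x\ast z)\big)$; (3) $(x\ast y)\ast\alpha(z)=(-1)^{|y||z|}(x\ast z)\ast\alpha(y)$. Cohomology: $C^n_\alpha(A,A)$ ($n\ge1$) is the space of $n$-linear maps $f:A\times\cdots\times A\to A$ with $\alpha(f(x_1,\dots,x_n))=f(\alpha(x_1),\dots,\alpha(x_n))$; $f$ is homogeneous of degree $|f|\in\mathbb{Z}_2$ if $f(A_{i_1},\dots,A_{i_n})\subseteq A_{i_1+\cdots+i_n+|f|}$.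 The operators $\delta^n_{hom}:C^n_\alpha(A,A)\to C^{n+1}_\alpha(A,A)$, $n=1,2$, are given on homogeneous $f$ and arguments (and extended linearly) by $$\delta^1_{hom}f(x_1,x_2)=(-1)^{|x_1||f|}x_1\ast f(x_2)+f(x_1)\ast x_2-f(x_1\ast x_2),$$ $$\begin{aligned}\delta^2_{hom}f(x_1,x_2,x_3)={}&f(\alpha(x_1),x_2\ast x_3)-(-1)^{|x_1||x_2|}f(\alpha(x_2),x_1\ast x_3)+(-1)^{|x_1||x_2|}f(x_2\ast x_1,\alpha(x_3))\\&+(-1)^{|x_1||f|}\alpha(x_1)\ast f(x_2,x_3)-(-1)^{|x_1||x_2|+|x_2||f|}\alpha(x_2)\ast f(x_1,x_3)\\&+(-1)^{|x_1||x_2|}f(x_2,x_1)\ast\alpha(x_3)-(-1)^{|x_2||x_3|}f(x_1\ast x_3,\alpha(x_2))-(-1)^{|x_2||x_3|}f(x_1,x_3)\ast\alpha(x_2).\end{aligned}$$ They satisfy $\delta^2_{hom}\delta^1_{hom}=0$. Put $Z^2_\alpha(A,A)=\ker\delta^2_{hom}$, $B^2_\alpha(A,A)=\delta^1_{hom}C^1_\alpha(A,A)$, $H^2_\alpha(A,A)=Z^2_\alpha(A,A)/B^2_\alpha(A,A)$. Deformations: $A[[t]]$ is the $\mathbf{F}[[t]]$-module of formal power series over $A$; $\mathbf{F}$-(bi)linear maps on $A$ are extended to be $\mathbf{F}[[t]]$-(bi)linear on $A[[t]]$ coefficientwise. A 1-parameter formal deformation of $(A,\ast,\alpha)$ is a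 formal power series $g_t(x,y)=\sum_{i\ge0}G_i(x,y)t^i:A[[t]]\times A[[t]]\to A[[t]]$, where each $G_i:A\times A\to A$ is an even $\mathbf{F}$-bilinear map, $G_0(x,y)=x\ast y$, such that $g_t(\alpha(x),\alpha(y))=\alpha(g_t(x,y))$; $g_t(\alpha(x),g_t(y,z))-g_t(g_t(x,y),\alpha(z))=(-1)^{|x||y|}\{g_t(\alpha(y),g_t(x,z))-g_t(g_t(y,x),\alpha(z))\}$; and $g_t(g_t(x,y),\alpha(z))=(-1)^{|y||z|}g_t(g_t(x,z),\alpha(y))$. (For any such deformation, $G_1\in Z^2_\alpha(A,A)$.) Two 1-parameter formal deformations $g_t,g_t'$ of $(A,\ast,\alpha)$ are equivalent if there is a formal isomorphism of $\mathbf{F}[[t]]$-modules $\phi_t=\sum_{i\ge0}\phi_it^i:A[[t]]\to A[[t]]$, with each $\phi_i:A\to A$ an $\mathbf{F}$-linear map and $\phi_0=\mathrm{id}_A$, satisfying $\phi_t\circ\alpha=\alpha\circ\phi_t$ and $\phi_t(g_t(x,y))=g_t'(\phi_t(x),\phi_t(y))$. *)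

theory Defs
  imports
    "HOL-Library.Z2"
    "HOL-Computational_Algebra.Formal_Power_Series"
begin

section \<open>Superspaces and Hom-Novikov superalgebras\<close>

text \<open>
  The underlying vector space of \<open>A\<close> is the whole type \<open>'a\<close>, with scalar multiplication
  \<open>scale\<close> over the field \<open>'f\<close>; \<open>A 0\<close> and \<open>A 1\<close> are the even and the odd part. Degrees live in
  the field \<open>bit\<close> of integers mod 2, so that products and sums of degrees in the exponents of
  the signs can be written literally.
\<close>

locale superspace = vector_space scale
  for scale :: "'f::field \<Rightarrow> 'a::ab_group_add \<Rightarrow> 'a" +
  fixes A :: "bit \<Rightarrow> 'a set"
  assumes subspace_part: "subspace (A i)"
    and part_Int: "A 0 \<inter> A 1 = {0}"
    and part_sum: "\<exists>a\<in>A 0. \<exists>b\<in>A 1. x = a + b"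

text \<open>\<open>neg1pow e v\<close> is $(-1)^e v$.\<close>

definition neg1pow :: "bit \<Rightarrow> 'a::ab_group_add \<Rightarrow> 'a" where
  "neg1pow e v = (if e = 0 then v else - v)"

definition bilin :: "('f::field \<Rightarrow> 'a::ab_group_add \<Rightarrow> 'a) \<Rightarrow> ('a \<Rightarrow> 'a \<Rightarrow> 'a) \<Rightarrow> bool" where
  "bilin scale f \<longleftrightarrow>
     (\<forall>x. Vector_Spaces.linear scale scale (\<lambda>y. f x y)) \<and>
     (\<forall>y. Vector_Spaces.linear scale scale (\<lambda>x. f x y))"

definition homogeneous1 :: "(bit \<Rightarrow> 'a set) \<Rightarrow> bit \<Rightarrow> ('a \<Rightarrow> 'a) \<Rightarrow> bool" where
  "homogeneous1 A d f \<longleftrightarrow> (\<forall>i. \<forall>x\<in>A i. f x \<in> A (i + d))"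

definition homogeneous2 :: "(bit \<Rightarrow> 'a set) \<Rightarrow> bit \<Rightarrow> ('a \<Rightarrow> 'a \<Rightarrow> 'a) \<Rightarrow> bool" where
  "homogeneous2 A d f \<longleftrightarrow> (\<forall>i j. \<forall>x\<in>A i. \<forall>y\<in>A j. f x y \<in> A (i + j + d))"

locale hom_novikov_superalgebra = superspace scale A
  for scale :: "'f::field \<Rightarrow> 'a::ab_group_add \<Rightarrow> 'a"
    and A :: "bit \<Rightarrow> 'a set" +
  fixes mul :: "'a \<Rightarrow> 'a \<Rightarrow> 'a"  (infixl \<open>\<star>\<close> 70)
    and \<alpha> :: "'a \<Rightarrow> 'a"
  assumes mul_bilin: "bilin scale mul"
    and mul_even: "homogeneous2 A 0 mul"
    and \<alpha>_linear: "Vector_Spaces.linear scale scale \<alpha>"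
    and \<alpha>_even: "homogeneous1 A 0 \<alpha>"
    and \<alpha>_mul: "\<lbrakk>x \<in> A i; y \<in> A j\<rbrakk> \<Longrightarrow> \<alpha> (x \<star> y) = \<alpha> x \<star> \<alpha> y"
    and hom_left_symmetric: "\<lbrakk>x \<in> A i; y \<in> A j; z \<in> A k\<rbrakk> \<Longrightarrow>
      (x \<star> y) \<star> \<alpha> z - \<alpha> x \<star> (y \<star> z)
      = neg1pow (i * j) ((y \<star> x) \<star> \<alpha> z - \<alpha> y \<star> (x \<star> z))"
    and hom_novikov: "\<lbrakk>x \<in> A i; y \<in> A j; z \<in> A k\<rbrakk> \<Longrightarrow>
      (x \<star> y) \<star> \<alpha> z = neg1pow (j * k) ((x \<star> z) \<star> \<alpha> y)"


section \<open>Cohomology\<close>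

definition C1 :: "('f::field \<Rightarrow> 'a::ab_group_add \<Rightarrow> 'a) \<Rightarrow> ('a \<Rightarrow> 'a) \<Rightarrow> ('a \<Rightarrow> 'a) set" where
  "C1 scale \<alpha> = {f. Vector_Spaces.linear scale scale f \<and> (\<forall>x. \<alpha> (f x) = f (\<alpha> x))}"

definition C2 :: "('f::field \<Rightarrow> 'a::ab_group_add \<Rightarrow> 'a) \<Rightarrow> ('a \<Rightarrow> 'a) \<Rightarrow> ('a \<Rightarrow> 'a \<Rightarrow> 'a) set" where
  "C2 scale \<alpha> = {f. bilin scale f \<and> (\<forall>x y. \<alpha> (f x y) = f (\<alpha> x) (\<alpha> y))}"

text \<open>
  \<open>part A i x\<close> is the component of \<open>x\<close> in \<open>A i\<close>; \<open>part1 A d f\<close> and \<open>part2 A d f\<close> are the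
  components of degree \<open>d\<close> of a linear and of a bilinear map.
\<close>

definition part :: "(bit \<Rightarrow> 'a set) \<Rightarrow> bit \<Rightarrow> 'a::ab_group_add \<Rightarrow> 'a" where
  "part A i x = (THE y. y \<in> A i \<and> x - y \<in> A (i + 1))"

definition part1 :: "(bit \<Rightarrow> 'a set) \<Rightarrow> bit \<Rightarrow> ('a::ab_group_add \<Rightarrow> 'a) \<Rightarrow> 'a \<Rightarrow> 'a" where
  "part1 A d f x = (\<Sum>i\<in>{0, 1}. part A (i + d) (f (part A i x)))"

definition part2 :: "(bit \<Rightarrow> 'a set) \<Rightarrow> bit \<Rightarrow> ('a::ab_group_add \<Rightarrow> 'a \<Rightarrow> 'a) \<Rightarrow> 'a \<Rightarrow> 'a \<Rightarrow> 'a" where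
  "part2 A d f x y =
     (\<Sum>i\<in>{0, 1}. \<Sum>j\<in>{0, 1}. part A (i + j + d) (f (part A i x) (part A j y)))"

text \<open>
  The formulas for the coboundary operators on a map \<open>f\<close> of degree \<open>d\<close> and arguments
  \<open>x\<^sub>1, x\<^sub>2, x\<^sub>3\<close> of degrees \<open>i, j, k\<close>.
\<close>

definition \<delta>1_formula ::
  "('a::ab_group_add \<Rightarrow> 'a \<Rightarrow> 'a) \<Rightarrow> bit \<Rightarrow> ('a \<Rightarrow> 'a) \<Rightarrow> bit \<Rightarrow> 'a \<Rightarrow> 'a \<Rightarrow> 'a" where
  "\<delta>1_formula mul d f i x1 x2 =
     neg1pow (i * d) (mul x1 (f x2)) + mul (f x1) x2 - f (mul x1 x2)"

definition \<delta>2_formula ::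
  "('a::ab_group_add \<Rightarrow> 'a \<Rightarrow> 'a) \<Rightarrow> ('a \<Rightarrow> 'a) \<Rightarrow> bit \<Rightarrow> ('a \<Rightarrow> 'a \<Rightarrow> 'a) \<Rightarrow>
     bit \<Rightarrow> bit \<Rightarrow> bit \<Rightarrow> 'a \<Rightarrow> 'a \<Rightarrow> 'a \<Rightarrow> 'a" where
  "\<delta>2_formula mul \<alpha> d f i j k x1 x2 x3 =
     f (\<alpha> x1) (mul x2 x3)
     - neg1pow (i * j) (f (\<alpha> x2) (mul x1 x3))
     + neg1pow (i * j) (f (mul x2 x1) (\<alpha> x3))
     + neg1pow (i * d) (mul (\<alpha> x1) (f x2 x3))
     - neg1pow (i * j + j * d) (mul (\<alpha> x2) (f x1 x3))
     + neg1pow (i * j) (mul (f x2 x1) (\<alpha> x3))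
     - neg1pow (j * k) (f (mul x1 x3) (\<alpha> x2))
     - neg1pow (j * k) (mul (f x1 x3) (\<alpha> x2))"

text \<open>
  The linear extensions of these formulas: the map and all arguments are decomposed into their
  homogeneous components. On homogeneous data the formulas are recovered, see the lemmas
  \<open>\<delta>1_homogeneous\<close> and \<open>\<delta>2_homogeneous\<close> below.
\<close>

definition \<delta>1 :: "(bit \<Rightarrow> 'a set) \<Rightarrow> ('a::ab_group_add \<Rightarrow> 'a \<Rightarrow> 'a) \<Rightarrow>
    ('a \<Rightarrow> 'a) \<Rightarrow> 'a \<Rightarrow> 'a \<Rightarrow> 'a" where
  "\<delta>1 A mul f x1 x2 =
     (\<Sum>d\<in>{0, 1}. \<Sum>i\<in>{0, 1}. \<Sum>j\<in>{0, 1}.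
        \<delta>1_formula mul d (part1 A d f) i (part A i x1) (part A j x2))"

definition \<delta>2 :: "(bit \<Rightarrow> 'a set) \<Rightarrow> ('a::ab_group_add \<Rightarrow> 'a \<Rightarrow> 'a) \<Rightarrow> ('a \<Rightarrow> 'a) \<Rightarrow>
    ('a \<Rightarrow> 'a \<Rightarrow> 'a) \<Rightarrow> 'a \<Rightarrow> 'a \<Rightarrow> 'a \<Rightarrow> 'a" where
  "\<delta>2 A mul \<alpha> f x1 x2 x3 =
     (\<Sum>d\<in>{0, 1}. \<Sum>i\<in>{0, 1}. \<Sum>j\<in>{0, 1}. \<Sum>k\<in>{0, 1}.
        \<delta>2_formula mul \<alpha> d (part2 A d f) i j k (part A i x1) (part A j x2) (part A k x3))"

definition Z2 :: "('f::field \<Rightarrow> 'a::ab_group_add \<Rightarrow> 'a) \<Rightarrow> (bit \<Rightarrow> 'a set) \<Rightarrow>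
    ('a \<Rightarrow> 'a \<Rightarrow> 'a) \<Rightarrow> ('a \<Rightarrow> 'a) \<Rightarrow> ('a \<Rightarrow> 'a \<Rightarrow> 'a) set" where
  "Z2 scale A mul \<alpha> = {f \<in> C2 scale \<alpha>. \<forall>x1 x2 x3. \<delta>2 A mul \<alpha> f x1 x2 x3 = 0}"

definition B2 :: "('f::field \<Rightarrow> 'a::ab_group_add \<Rightarrow> 'a) \<Rightarrow> (bit \<Rightarrow> 'a set) \<Rightarrow>
    ('a \<Rightarrow> 'a \<Rightarrow> 'a) \<Rightarrow> ('a \<Rightarrow> 'a) \<Rightarrow> ('a \<Rightarrow> 'a \<Rightarrow> 'a) set" where
  "B2 scale A mul \<alpha> = \<delta>1 A mul ` C1 scale \<alpha>"

text \<open>The elements of \<open>H2\<close> are the cohomology classes, as sets of cocycles.\<close>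

definition H2 :: "('f::field \<Rightarrow> 'a::ab_group_add \<Rightarrow> 'a) \<Rightarrow> (bit \<Rightarrow> 'a set) \<Rightarrow>
    ('a \<Rightarrow> 'a \<Rightarrow> 'a) \<Rightarrow> ('a \<Rightarrow> 'a) \<Rightarrow> ('a \<Rightarrow> 'a \<Rightarrow> 'a) set set" where
  "H2 scale A mul \<alpha> =
     Z2 scale A mul \<alpha> //
       {(f, g). f \<in> Z2 scale A mul \<alpha> \<and> g \<in> Z2 scale A mul \<alpha> \<and>
          (\<lambda>x y. f x y - g x y) \<in> B2 scale A mul \<alpha>}"


section \<open>Formal deformations\<close>

text \<open>
  $A[[t]]$ is the type \<open>'a fps\<close>. The library provides its additive group and the ring
  \<open>'f fps\<close>; the \<open>'f fps\<close>-module structure is the Cauchy product \<open>fps_scale\<close>.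
\<close>

definition fps_scale :: "('f::field \<Rightarrow> 'a::ab_group_add \<Rightarrow> 'a) \<Rightarrow> 'f fps \<Rightarrow> 'a fps \<Rightarrow> 'a fps" where
  "fps_scale scale c x = Abs_fps (\<lambda>n. \<Sum>i\<le>n. scale (fps_nth c i) (fps_nth x (n - i)))"

definition fps_part :: "(bit \<Rightarrow> 'a set) \<Rightarrow> bit \<Rightarrow> 'a fps set" where
  "fps_part A i = {x. \<forall>n. fps_nth x n \<in> A i}"

text \<open>Coefficientwise extension of a map of \<open>A\<close> to $A[[t]]$.\<close>

definition fps_map :: "('a \<Rightarrow> 'a) \<Rightarrow> 'a fps \<Rightarrow> 'a fps" where
  "fps_map f x = Abs_fps (\<lambda>n. f (fps_nth x n))"

text \<open>
  The maps $\sum_i \phi_i t^i$ and $\sum_i G_i t^i$ on $A[[t]]$, where each $\phi_i$ and $G_i$ is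
  extended from \<open>A\<close> to be (bi)linear over the power series.
\<close>

definition formal_map :: "(nat \<Rightarrow> 'a::ab_group_add \<Rightarrow> 'a) \<Rightarrow> 'a fps \<Rightarrow> 'a fps" where
  "formal_map \<phi> x = Abs_fps (\<lambda>n. \<Sum>i\<le>n. \<phi> i (fps_nth x (n - i)))"

definition formal_product ::
    "(nat \<Rightarrow> 'a::ab_group_add \<Rightarrow> 'a \<Rightarrow> 'a) \<Rightarrow> 'a fps \<Rightarrow> 'a fps \<Rightarrow> 'a fps" where
  "formal_product G x y =
     Abs_fps (\<lambda>n. \<Sum>i\<le>n. \<Sum>j\<le>n - i. G i (fps_nth x j) (fps_nth y (n - i - j)))"

definition formal_deformation ::
    "('f::field \<Rightarrow> 'a::ab_group_add \<Rightarrow> 'a) \<Rightarrow> (bit \<Rightarrow> 'a set) \<Rightarrow>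
     ('a \<Rightarrow> 'a \<Rightarrow> 'a) \<Rightarrow> ('a \<Rightarrow> 'a) \<Rightarrow> (nat \<Rightarrow> 'a \<Rightarrow> 'a \<Rightarrow> 'a) \<Rightarrow> bool" where
  "formal_deformation scale A mul \<alpha> G \<longleftrightarrow>
     (\<forall>n. bilin scale (G n) \<and> homogeneous2 A 0 (G n)) \<and>
     (\<forall>x y. G 0 x y = mul x y) \<and>
     (let g = formal_product G; a = fps_map \<alpha> in
       (\<forall>x y. g (a x) (a y) = a (g x y)) \<and>
       (\<forall>i j k. \<forall>x\<in>fps_part A i. \<forall>y\<in>fps_part A j. \<forall>z\<in>fps_part A k.
          g (a x) (g y z) - g (g x y) (a z)
          = neg1pow (i * j) (g (a y) (g x z) - g (g y x) (a z))) \<and>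
       (\<forall>i j k. \<forall>x\<in>fps_part A i. \<forall>y\<in>fps_part A j. \<forall>z\<in>fps_part A k.
          g (g x y) (a z) = neg1pow (j * k) (g (g x z) (a y))))"

text \<open>The maps \<open>\<phi> n\<close> are linear, but not required to be even.\<close>

definition equivalent_deformations ::
    "('f::field \<Rightarrow> 'a::ab_group_add \<Rightarrow> 'a) \<Rightarrow> ('a \<Rightarrow> 'a) \<Rightarrow>
     (nat \<Rightarrow> 'a \<Rightarrow> 'a \<Rightarrow> 'a) \<Rightarrow> (nat \<Rightarrow> 'a \<Rightarrow> 'a \<Rightarrow> 'a) \<Rightarrow> bool" where
  "equivalent_deformations scale \<alpha> G G' \<longleftrightarrow>
     (\<exists>\<phi> :: nat \<Rightarrow> 'a \<Rightarrow> 'a.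
        (\<forall>n. Vector_Spaces.linear scale scale (\<phi> n)) \<and> \<phi> 0 = id \<and>
        module_hom (fps_scale scale) (fps_scale scale) (formal_map \<phi>) \<and>
        bij (formal_map \<phi>) \<and>
        formal_map \<phi> \<circ> fps_map \<alpha> = fps_map \<alpha> \<circ> formal_map \<phi> \<and>
        (\<forall>x y. formal_map \<phi> (formal_product G x y)
               = formal_product G' (formal_map \<phi> x) (formal_map \<phi> y)))"


section \<open>Consistency of the definitions\<close>

lemma bit_cases01: "(i::bit) = 0 \<or> i = 1"
  by (cases i) auto

context superspace
begin

lemma part_ex1: "\<exists>!y. y \<in> A i \<and> x - y \<in> A (i + 1)"
proof -
  have int: "z = 0" if "z \<in> A i" "z \<in> A (i + 1)" for z
    using part_Int that by (cases i) auto
  obtain a b where ab: "a \<in> A 0" "b \<in> A 1" "x = a + b"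
    using part_sum by blast
  have "\<exists>y. y \<in> A i \<and> x - y \<in> A (i + 1)"
    using ab by (cases i) (auto intro: exI[of _ a] exI[of _ b])
  moreover have "y = z" if "y \<in> A i \<and> x - y \<in> A (i + 1)" "z \<in> A i \<and> x - z \<in> A (i + 1)" for y z
  proof -
    have "y - z \<in> A i" using that subspace_diff[OF subspace_part] by blast
    moreover have "(x - z) - (x - y) \<in> A (i + 1)"
      using that subspace_diff[OF subspace_part] by blast
    ultimately show ?thesis using int[of "y - z"] by simp
  qed
  ultimately show ?thesis by blast
qed

lemma zero_in_part: "0 \<in> A i"
  using subspace_part subspace_0 by blast

lemma part_in: "part A i x \<in> A i"
  using theI'[OF part_ex1[of i x]] by (simp add: part_def)

lemma part_unique: "y \<in> A i \<Longrightarrow> x - y \<in> A (i + 1) \<Longrightarrow> part A i x = y"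
  using the1_equality[OF part_ex1[of i x]] by (simp add: part_def)

lemma part_homogeneous: "x \<in> A j \<Longrightarrow> part A i x = (if i = j then x else 0)"
  by (cases i; cases j) (auto intro!: part_unique simp: zero_in_part)

lemma part_zero: "part A i 0 = 0"
  by (rule part_unique) (simp_all add: zero_in_part)

lemma part_decomp: "part A 0 x + part A 1 x = x"
proof -
  obtain a b where ab: "a \<in> A 0" "b \<in> A 1" "x = a + b"
    using part_sum by blast
  have "part A 0 x = a" "part A 1 x = b"
    by (rule part_unique; use ab in simp)+
  with ab show ?thesis by simp
qed

lemma linear_eq_0: "Vector_Spaces.linear scale scale f \<Longrightarrow> f 0 = 0"
  by (metis module_hom.zero module_hom_iff_linear)

lemma linear_add: "Vector_Spaces.linear scale scale f \<Longrightarrow> f (x + y) = f x + f y"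
  by (metis module_hom.add module_hom_iff_linear)

lemma part1_homogeneous:
  assumes "Vector_Spaces.linear scale scale f" "homogeneous1 A d f"
  shows "part1 A e f = (if e = d then f else (\<lambda>_. 0))"
proof
  fix x
  have m: "f (part A i x) \<in> A (i + d)" for i
    using assms(2) part_in by (auto simp: homogeneous1_def)
  have "f x = f (part A 0 x) + f (part A 1 x)"
    by (metis linear_add[OF assms(1)] part_decomp)
  then show "part1 A e f x = (if e = d then f else (\<lambda>_. 0)) x"
    using part_homogeneous[OF m[of 0]] part_homogeneous[OF m[of 1]]
    by (auto simp: part1_def)
qed

lemma bilin_eq_0: "bilin scale f \<Longrightarrow> f 0 y = 0" "bilin scale f \<Longrightarrow> f x 0 = 0"
  unfolding bilin_def by (metis linear_eq_0)+

lemma part2_homogeneous: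
  assumes "bilin scale f" "homogeneous2 A d f"
  shows "part2 A e f = (if e = d then f else (\<lambda>_ _. 0))"
proof (intro ext)
  fix x y
  have m: "f (part A i x) (part A j y) \<in> A (i + j + d)" for i j
    using assms(2) part_in by (auto simp: homogeneous2_def)
  have "f x y = f (part A 0 x) y + f (part A 1 x) y" for x y
    using assms(1) linear_add[of "\<lambda>x. f x y"] part_decomp[of x] by (metis bilin_def)
  moreover have "f x y = f x (part A 0 y) + f x (part A 1 y)" for x y
    using assms(1) linear_add[of "\<lambda>y. f x y"] part_decomp[of y] by (metis bilin_def)
  ultimately have "f x y = f (part A 0 x) (part A 0 y) + f (part A 0 x) (part A 1 y)
      + (f (part A 1 x) (part A 0 y) + f (part A 1 x) (part A 1 y))"
    by metis
  then show "part2 A e f x y = (if e = d then f else (\<lambda>_ _. 0)) x y"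
    using part_homogeneous[OF m[of 0 0]] part_homogeneous[OF m[of 0 1]]
      part_homogeneous[OF m[of 1 0]] part_homogeneous[OF m[of 1 1]]
    by (auto simp: part2_def)
qed

lemma fps_scale_module: "module (fps_scale scale)"
proof
  fix a b :: "'f fps" and x y :: "'a fps"
  show "fps_scale scale a (x + y) = fps_scale scale a x + fps_scale scale a y"
    by (simp add: fps_scale_def fps_eq_iff scale_right_distrib sum.distrib)
  show "fps_scale scale (a + b) x = fps_scale scale a x + fps_scale scale b x"
    by (simp add: fps_scale_def fps_eq_iff scale_left_distrib sum.distrib)
  show "fps_scale scale 1 x = x"
  proof (rule fps_ext)
    fix n
    have "fps_nth (fps_scale scale 1 x) n
        = (\<Sum>i\<le>n. if i = 0 then fps_nth x n else 0)"
      unfolding fps_scale_def fps_nth_Abs_fps by (rule sum.cong) auto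
    then show "fps_nth (fps_scale scale 1 x) n = fps_nth x n" by simp
  qed
  show "fps_scale scale a (fps_scale scale b x) = fps_scale scale (a * b) x"
  proof (rule fps_ext)
    fix n
    let ?f = "\<lambda>i j. scale (fps_nth a i * fps_nth b j) (fps_nth x (n - i - j))"
    have "fps_nth (fps_scale scale a (fps_scale scale b x)) n
        = (\<Sum>i\<le>n. \<Sum>j\<le>n - i. ?f i j)"
      by (simp add: fps_scale_def scale_sum_right)
    also have "\<dots> = (\<Sum>k\<le>n. \<Sum>i\<le>k. ?f i (k - i))"
      unfolding sum.Sigma[OF finite_atMost ballI[OF finite_atMost]]
      by (rule sum.reindex_bij_witness[of _ "\<lambda>(k, i). (i, k - i)" "\<lambda>(i, j). (i + j, i)"]) auto
    also have "\<dots> = fps_nth (fps_scale scale (a * b) x) n"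
      by (auto simp: fps_scale_def fps_mult_nth scale_sum_left atMost_atLeast0 intro!: sum.cong)
    finally show "fps_nth (fps_scale scale a (fps_scale scale b x)) n
        = fps_nth (fps_scale scale (a * b) x) n" .
  qed
qed

end

context hom_novikov_superalgebra
begin

lemma \<delta>1_homogeneous:
  assumes "Vector_Spaces.linear scale scale f" "homogeneous1 A d f" "x1 \<in> A i" "x2 \<in> A j"
  shows "\<delta>1 A mul f x1 x2 = \<delta>1_formula mul d f i x1 x2"
  using assms(3,4)
  by (cases d; cases i; cases j)
     (simp_all add: \<delta>1_def \<delta>1_formula_def part1_homogeneous[OF assms(1,2)] part_homogeneous
       neg1pow_def bilin_eq_0[OF mul_bilin] linear_eq_0[OF assms(1)])

lemma \<delta>2_homogeneous:
  assumes "bilin scale f" "homogeneous2 A d f" "x1 \<in> A i" "x2 \<in> A j" "x3 \<in> A k"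
  shows "\<delta>2 A mul \<alpha> f x1 x2 x3 = \<delta>2_formula mul \<alpha> d f i j k x1 x2 x3"
  using assms(3-5)
  by (cases d; cases i; cases j; cases k)
     (simp_all add: \<delta>2_def \<delta>2_formula_def part2_homogeneous[OF assms(1,2)] part_homogeneous
       neg1pow_def bilin_eq_0[OF mul_bilin] bilin_eq_0[OF assms(1)] linear_eq_0[OF \<alpha>_linear])

end

end

theory Submission
  imports Defs
begin

text \<open>
  Comparing the coefficients of \<open>t\<close> in the equivalence gives
  \<open>G\<^sub>1(x,y) - G'\<^sub>1(x,y) = x \<star> \<phi>\<^sub>1(y) + \<phi>\<^sub>1(x) \<star> y - \<phi>\<^sub>1(x \<star> y)\<close>. Because of
  the sign in \<open>\<delta>\<^sup>1\<close>, the right-hand side need not be \<open>\<delta>\<^sup>1 \<phi>\<^sub>1\<close> unless \<open>\<phi>\<^sub>1\<close> is even. Since the left-hand side is even, taking components of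
  degree \<open>|x| + |y|\<close> allows \<open>\<phi>\<^sub>1\<close> to be replaced by its even part.
\<close>

section \<open>Coefficients of order at most one, and elimination rules for deformations\<close>

lemma bilinD:
  assumes "bilin scale f"
  shows "Vector_Spaces.linear scale scale (f x)"
    and "Vector_Spaces.linear scale scale (\<lambda>x. f x y)"
  using assms by (simp_all add: bilin_def)

lemma fps_nth_formal_map_1:
  "fps_nth (formal_map \<phi> x) 1 = \<phi> 0 (fps_nth x 1) + \<phi> 1 (fps_nth x 0)"
  by (simp add: formal_map_def)

lemma fps_nth_formal_product_0:
  "fps_nth (formal_product G x y) 0 = G 0 (fps_nth x 0) (fps_nth y 0)"
  by (simp add: formal_product_def)

text \<open>A single factor \<open>t\<close> can come from the second argument, from the first, or
  from the index of \<open>G\<close>; hence three terms.\<close>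

lemma fps_nth_formal_product_1:
  "fps_nth (formal_product G x y) 1 =
    G 0 (fps_nth x 0) (fps_nth y 1) + G 0 (fps_nth x 1) (fps_nth y 0)
    + G 1 (fps_nth x 0) (fps_nth y 0)"
  by (simp add: formal_product_def)

lemma fps_nth_fps_map [simp]: "fps_nth (fps_map f x) n = f (fps_nth x n)"
  by (simp add: fps_map_def)

lemma fps_nth_neg1pow: "fps_nth (neg1pow e x) n = neg1pow e (fps_nth x n)"
  by (simp add: neg1pow_def)

lemma formal_deformationD:
  assumes "formal_deformation scale A mul \<alpha> G"
  shows "bilin scale (G n)" and "homogeneous2 A 0 (G n)" and "G 0 = mul"
    and "formal_product G (fps_map \<alpha> x) (fps_map \<alpha> y) = fps_map \<alpha> (formal_product G x y)"
    and "\<lbrakk>x \<in> fps_part A i; y \<in> fps_part A j; z \<in> fps_part A k\<rbrakk> \<Longrightarrow>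
      formal_product G (fps_map \<alpha> x) (formal_product G y z)
        - formal_product G (formal_product G x y) (fps_map \<alpha> z)
      = neg1pow (i * j)
          (formal_product G (fps_map \<alpha> y) (formal_product G x z)
            - formal_product G (formal_product G y x) (fps_map \<alpha> z))"
    and "\<lbrakk>x \<in> fps_part A i; y \<in> fps_part A j; z \<in> fps_part A k\<rbrakk> \<Longrightarrow>
      formal_product G (formal_product G x y) (fps_map \<alpha> z)
      = neg1pow (j * k) (formal_product G (formal_product G x z) (fps_map \<alpha> y))"
proof -
  note D = assms[unfolded formal_deformation_def Let_def]
  show "bilin scale (G n)" "homogeneous2 A 0 (G n)"
    using D[THEN conjunct1] by simp_all
  show "G 0 = mul"
    using D[THEN conjunct2, THEN conjunct1] by (intro ext) simp
  note D' = D[THEN conjunct2, THEN conjunct2]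
  show "formal_product G (fps_map \<alpha> x) (fps_map \<alpha> y) = fps_map \<alpha> (formal_product G x y)"
    by (rule D'[THEN conjunct1, rule_format])
  show "formal_product G (fps_map \<alpha> x) (formal_product G y z)
        - formal_product G (formal_product G x y) (fps_map \<alpha> z)
      = neg1pow (i * j)
          (formal_product G (fps_map \<alpha> y) (formal_product G x z)
            - formal_product G (formal_product G y x) (fps_map \<alpha> z))"
    if "x \<in> fps_part A i" "y \<in> fps_part A j" "z \<in> fps_part A k"
    by (rule D'[THEN conjunct2, THEN conjunct1, rule_format, OF that])
  show "formal_product G (formal_product G x y) (fps_map \<alpha> z)
      = neg1pow (j * k) (formal_product G (formal_product G x z) (fps_map \<alpha> y))"
    if "x \<in> fps_part A i" "y \<in> fps_part A j" "z \<in> fps_part A k"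
    by (rule D'[THEN conjunct2, THEN conjunct2, rule_format, OF that])
qed

section \<open>Parity components of linear and bilinear maps\<close>

context superspace
begin

lemma fps_const_in_fps_part: "x \<in> A i \<Longrightarrow> fps_const x \<in> fps_part A i"
  by (auto simp: fps_part_def zero_in_part)

lemma linear_iff_add_scale:
  "Vector_Spaces.linear scale scale f \<longleftrightarrow>
    (\<forall>x y. f (x + y) = f x + f y) \<and> (\<forall>c x. f (scale c x) = scale c (f x))"
  using module_axioms
  by (auto simp: module_hom_iff_linear[symmetric] module_hom_def module_hom_axioms_def)

text \<open>The decomposition into homogeneous components is unique and each part is a subspace, so
  sums and multiples of components are again components.\<close>

lemma linear_part: "Vector_Spaces.linear scale scale (part A i)"
proof -
  have add: "part A i (x + y) = part A i x + part A i y" for x y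
  proof (rule part_unique)
    show "part A i x + part A i y \<in> A i"
      using subspace_add[OF subspace_part] part_in by blast
    have "(x - part A i x) + (y - part A i y) \<in> A (i + 1)"
      using subspace_add[OF subspace_part] theI'[OF part_ex1]
      by (metis part_def)
    then show "x + y - (part A i x + part A i y) \<in> A (i + 1)"
      by (simp add: algebra_simps)
  qed
  have scl: "part A i (scale c x) = scale c (part A i x)" for c x
  proof (rule part_unique)
    show "scale c (part A i x) \<in> A i"
      using subspace_scale[OF subspace_part] part_in by blast
    have "scale c (x - part A i x) \<in> A (i + 1)"
      using subspace_scale[OF subspace_part] theI'[OF part_ex1]
      by (metis part_def)
    then show "scale c x - scale c (part A i x) \<in> A (i + 1)"
      by (simp add: scale_right_diff_distrib)
  qed
  show ?thesis
    using add scl by (simp add: linear_iff_add_scale)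
qed

lemmas part_add = linear_add[OF linear_part]

lemma linear_diff: "Vector_Spaces.linear scale scale f \<Longrightarrow> f (x - y) = f x - f y"
  by (metis eq_diff_eq linear_add)

text \<open>A map of degree \<open>d\<close> carries the decomposition of \<open>x\<close> to a
  decomposition of \<open>f x\<close> with degrees shifted by \<open>d\<close>; uniqueness does the
  rest.\<close>

lemma linear_homogeneous_part:
  assumes "Vector_Spaces.linear scale scale f" and "homogeneous1 A d f"
  shows "part A (i + d) (f x) = f (part A i x)"
proof (rule part_unique)
  show "f (part A i x) \<in> A (i + d)"
    using assms(2) part_in by (auto simp: homogeneous1_def)
  have "x - part A i x \<in> A (i + 1)"
    using theI'[OF part_ex1[of i x]] by (simp add: part_def)
  then have "f (x - part A i x) \<in> A (i + 1 + d)"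
    using assms(2) unfolding homogeneous1_def by blast
  then show "f x - f (part A i x) \<in> A (i + d + 1)"
    by (simp only: linear_diff[OF assms(1)] ac_simps)
qed

lemma linear_part1:
  assumes "Vector_Spaces.linear scale scale f"
  shows "Vector_Spaces.linear scale scale (part1 A d f)"
  using assms linear_part
  by (simp add: linear_iff_add_scale part1_def scale_right_distrib)

text \<open>One component of a homogeneous \<open>x\<close> is \<open>x\<close> itself and the other
  is 0, so a single summand of \<open>part1\<close> survives.\<close>

lemma part1_of_homogeneous:
  assumes "Vector_Spaces.linear scale scale f" and "x \<in> A i"
  shows "part1 A d f x = part A (i + d) (f x)"
  using assms(2)
  by (cases i) (simp_all add: part1_def part_homogeneous linear_eq_0[OF assms(1)] part_zero)

lemma homogeneous1_part1:
  "Vector_Spaces.linear scale scale f \<Longrightarrow> homogeneous1 A d (part1 A d f)"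
  by (simp add: homogeneous1_def part1_of_homogeneous part_in)

lemma bilin_decomp:
  assumes "bilin scale f"
  shows "f x y = (\<Sum>i\<in>{0, 1}. \<Sum>j\<in>{0, 1}. f (part A i x) (part A j y))"
proof -
  have "f x y = f (part A 0 x + part A 1 x) (part A 0 y + part A 1 y)"
    by (simp only: part_decomp)
  then show ?thesis
    by (simp add: linear_add[OF bilinD(1)[OF assms]] linear_add[OF bilinD(2)[OF assms]]
        algebra_simps)
qed

lemma bilin_diff:
  assumes "bilin scale f" and "bilin scale g"
  shows "bilin scale (\<lambda>x y. f x y - g x y)"
  using assms
  by (simp add: bilin_def linear_iff_add_scale scale_right_diff_distrib)

text \<open>An even \<open>h\<close> commutes with the projections \<open>part A i\<close>, out of
  which \<open>part1\<close> is built. With \<open>h\<close> equal to \<alpha>, this keeps the even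
  part of a cochain inside \<open>C1\<close>.\<close>

lemma commute_part1:
  assumes f: "Vector_Spaces.linear scale scale f" and h: "Vector_Spaces.linear scale scale h"
    and h0: "homogeneous1 A 0 h" and comm: "\<And>x. h (f x) = f (h x)"
  shows "h (part1 A d f x) = part1 A d f (h x)"
proof -
  note part_h = linear_homogeneous_part[OF h h0, unfolded add_0_right]
  show ?thesis
    by (simp add: part1_def linear_add[OF h] comm flip: part_h)
qed

end

section \<open>Coboundaries of even maps\<close>

context hom_novikov_superalgebra
begin

text \<open>In degree 0 every sign is +1, and the odd component of \<open>f\<close> vanishes.
  Bilinearity then recombines the components, so the formula holds for arbitrary arguments.\<close>

lemma \<delta>1_even:
  assumes f: "Vector_Spaces.linear scale scale f" and f0: "homogeneous1 A 0 f"
  shows "\<delta>1 A mul f x y = x \<star> f y + f x \<star> y - f (x \<star> y)"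
proof -
  have "\<delta>1 A mul f x y =
      (\<Sum>i\<in>{0, 1}. \<Sum>j\<in>{0, 1}. part A i x \<star> f (part A j y) + f (part A i x) \<star> part A j y
        - f (part A i x \<star> part A j y))"
    by (simp add: \<delta>1_def \<delta>1_formula_def part1_homogeneous[OF f f0] neg1pow_def
        bilin_eq_0[OF mul_bilin])
  also have "\<dots> = x \<star> f y + f x \<star> y - f (x \<star> y)"
  proof -
    have "x \<star> f y = (part A 0 x + part A 1 x) \<star> f (part A 0 y + part A 1 y)"
      and "f x \<star> y = f (part A 0 x + part A 1 x) \<star> (part A 0 y + part A 1 y)"
      and "f (x \<star> y) = f ((part A 0 x + part A 1 x) \<star> (part A 0 y + part A 1 y))"
      by (simp_all only: part_decomp)
    then show ?thesis
      by (simp add: linear_add[OF bilinD(1)[OF mul_bilin]] linear_add[OF bilinD(2)[OF mul_bilin]]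
          linear_add[OF f] algebra_simps)
  qed
  finally show ?thesis .
qed

text \<open>Left multiplication by \<open>x\<close> is a linear map of degree \<open>i\<close>;
  right multiplication by a homogeneous element is treated likewise below.\<close>

lemma part_mul_left:
  assumes "x \<in> A i"
  shows "part A (i + j) (x \<star> y) = x \<star> part A j y"
proof -
  have "homogeneous1 A i (\<lambda>y. x \<star> y)"
    using mul_even assms unfolding homogeneous1_def homogeneous2_def
    by (metis add.commute add_0_right)
  from linear_homogeneous_part[OF bilinD(1)[OF mul_bilin] this, of j y] show ?thesis
    by (simp only: add.commute)
qed

lemma part_mul_right:
  assumes "y \<in> A j"
  shows "part A (i + j) (x \<star> y) = part A i x \<star> y"
proof -
  have "homogeneous1 A j (\<lambda>x. x \<star> y)"
    using mul_even assms unfolding homogeneous1_def homogeneous2_def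
    by (metis add_0_right)
  from linear_homogeneous_part[OF bilinD(2)[OF mul_bilin] this] show ?thesis .
qed

text \<open>For arguments of degrees \<open>i\<close> and \<open>j\<close>, projecting
  \<open>eq\<close> to degree \<open>i + j\<close> leaves the even map \<open>h\<close> unchanged
  and turns each \<open>f\<close> into its even part, for which \<open>\<delta>1\<close> carries no
  signs.\<close>

lemma even_eq_\<delta>1_part1:
  assumes h: "bilin scale h" and h0: "homogeneous2 A 0 h"
    and f: "Vector_Spaces.linear scale scale f"
    and eq: "\<And>x y. h x y = x \<star> f y + f x \<star> y - f (x \<star> y)"
  shows "h = \<delta>1 A mul (part1 A 0 f)"
proof (intro ext)
  fix x y
  note f0 = linear_part1[OF f, of 0] homogeneous1_part1[OF f, of 0]
  have hom: "h u v = \<delta>1 A mul (part1 A 0 f) u v" if "u \<in> A i" "v \<in> A j" for u v i j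
  proof -
    have uv: "h u v \<in> A (i + j)" "u \<star> v \<in> A (i + j)"
      using that h0 mul_even unfolding homogeneous2_def by fastforce+
    have "h u v = part A (i + j) (h u v)"
      using part_homogeneous[OF uv(1)] by simp
    also have "\<dots> = u \<star> part A j (f v) + part A i (f u) \<star> v - part A (i + j) (f (u \<star> v))"
      by (simp only: eq linear_diff[OF linear_part] part_add part_mul_left[OF that(1)]
          part_mul_right[OF that(2)])
    \<comment> \<open>Projecting \<open>f v\<close> to the degree of \<open>v\<close> amounts to
      applying the even part of \<open>f\<close>; likewise for \<open>u\<close> and
      \<open>u \<star> v\<close>.\<close>
    also have "\<dots> = \<delta>1 A mul (part1 A 0 f) u v"
      using that uv(2) by (simp add: \<delta>1_even[OF f0] part1_of_homogeneous[OF f])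
    finally show ?thesis .
  qed
  have "h x y = (\<Sum>i\<in>{0, 1}. \<Sum>j\<in>{0, 1}. \<delta>1 A mul (part1 A 0 f) (part A i x) (part A j y))"
    by (simp only: bilin_decomp[OF h, of x y] hom[OF part_in part_in])
  \<comment> \<open>\<open>\<delta>1\<close> is itself defined by summing over homogeneous
    components, so both sides unfold to the same terms.\<close>
  also have "\<dots> = \<delta>1 A mul (part1 A 0 f) x y"
    by (simp add: \<delta>1_def part_homogeneous[OF part_in] \<delta>1_formula_def neg1pow_def
        bilin_eq_0[OF mul_bilin] part1_homogeneous[OF f0] linear_eq_0[OF f0(1)])
  finally show "h x y = \<delta>1 A mul (part1 A 0 f) x y" .
qed

text \<open>The zero map is the coboundary of the zero cochain. This places \<open>G 1\<close> in
  its own cohomology class.\<close>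

lemma zero_in_B2: "(\<lambda>_ _. 0) \<in> B2 scale A mul \<alpha>"
proof -
  have lin: "Vector_Spaces.linear scale scale (\<lambda>_. 0)"
    by (simp add: linear_iff_add_scale)
  have "(\<lambda>_ _. 0) = \<delta>1 A mul (\<lambda>_. 0)"
    by (intro ext)
      (simp add: \<delta>1_even[OF lin] homogeneous1_def zero_in_part bilin_eq_0[OF mul_bilin])
  moreover have "(\<lambda>_. 0) \<in> C1 scale \<alpha>"
    using lin by (simp add: C1_def linear_eq_0[OF \<alpha>_linear])
  ultimately show ?thesis
    unfolding B2_def by (rule image_eqI)
qed

section \<open>First-order terms of deformations and of equivalences\<close>

lemma deformation_in_Z2:
  assumes "formal_deformation scale A mul \<alpha> G"
  shows "G 1 \<in> Z2 scale A mul \<alpha>"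
proof -
  note D = formal_deformationD[OF assms]
  note bil = D(1)[of 1] and ev = D(2)[of 1] and G0 = D(3)
  note zero = bilin_eq_0[OF mul_bilin] bilin_eq_0[OF bil] linear_eq_0[OF \<alpha>_linear]
  note coeff = fps_nth_formal_product_1 fps_nth_formal_product_0
  \<comment> \<open>Here and in \<open>ls\<close> and \<open>nov\<close> the identities are tested
    on constant series: their higher coefficients vanish, so the coefficient of \<open>t\<close>
    retains just the terms linear in \<open>G 1\<close>.\<close>
  have \<alpha>_G1: "\<alpha> (G 1 x y) = G 1 (\<alpha> x) (\<alpha> y)" for x y
    using arg_cong[OF D(4)[of "fps_const x" "fps_const y"], of "\<lambda>u. fps_nth u 1"]
    unfolding fps_nth_fps_map coeff by (simp add: G0 zero)
  have formula_0: "\<delta>2_formula mul \<alpha> 0 (G 1) i j k x y z = 0"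
    if "x \<in> A i" "y \<in> A j" "z \<in> A k" for x y z i j k
  proof -
    note c = that[THEN fps_const_in_fps_part]
    have ls: "G 1 (\<alpha> x) (y \<star> z) + \<alpha> x \<star> G 1 y z - (G 1 (x \<star> y) (\<alpha> z) + G 1 x y \<star> \<alpha> z)
      = neg1pow (i * j) (G 1 (\<alpha> y) (x \<star> z) + \<alpha> y \<star> G 1 x z
          - (G 1 (y \<star> x) (\<alpha> z) + G 1 y x \<star> \<alpha> z))"
      using arg_cong[OF D(5)[OF c], of "\<lambda>u. fps_nth u 1"]
      unfolding fps_nth_neg1pow fps_sub_nth coeff fps_nth_fps_map
      by (simp add: G0 zero algebra_simps)
    have nov: "G 1 (x \<star> y) (\<alpha> z) + G 1 x y \<star> \<alpha> z
      = neg1pow (j * k) (G 1 (x \<star> z) (\<alpha> y) + G 1 x z \<star> \<alpha> y)"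
      using arg_cong[OF D(6)[OF c], of "\<lambda>u. fps_nth u 1"]
      unfolding fps_nth_neg1pow coeff fps_nth_fps_map
      by (simp add: G0 zero algebra_simps)
    \<comment> \<open>The cocycle expression is the defect of \<open>ls\<close> plus the defect of
      \<open>nov\<close>. The terms in \<open>x \<star> y\<close> and \<open>G 1 x y\<close> cancel
      between the two, which leaves the eight terms of \<open>\<delta>2_formula\<close>.\<close>
    have "\<delta>2_formula mul \<alpha> 0 (G 1) i j k x y z =
      (G 1 (\<alpha> x) (y \<star> z) + \<alpha> x \<star> G 1 y z - (G 1 (x \<star> y) (\<alpha> z) + G 1 x y \<star> \<alpha> z))
      - neg1pow (i * j) (G 1 (\<alpha> y) (x \<star> z) + \<alpha> y \<star> G 1 x z
          - (G 1 (y \<star> x) (\<alpha> z) + G 1 y x \<star> \<alpha> z))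
      + (G 1 (x \<star> y) (\<alpha> z) + G 1 x y \<star> \<alpha> z
        - neg1pow (j * k) (G 1 (x \<star> z) (\<alpha> y) + G 1 x z \<star> \<alpha> y))"
      by (cases "i * j = 0"; cases "j * k = 0")
        (simp_all add: \<delta>2_formula_def neg1pow_def algebra_simps)
    then show ?thesis
      by (simp only: ls[THEN right_minus_eq[THEN iffD2]] nov[THEN right_minus_eq[THEN iffD2]]
          add_0_left)
  qed
  have "\<delta>2_formula mul \<alpha> d (part2 A d (G 1)) i j k (part A i x) (part A j y) (part A k z) = 0"
    for d i j k x y z
  \<comment> \<open>As \<open>G 1\<close> is even, its component of degree \<open>d\<close> is
    \<open>G 1\<close> for \<open>d = 0\<close> and the zero map otherwise.\<close>
  proof (cases "d = 0")
    case True
    then show ?thesis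
      by (simp only: part2_homogeneous[OF bil ev] simp_thms if_True formula_0[OF part_in part_in part_in])
  next
    case False
    then show ?thesis
      by (simp only: part2_homogeneous[OF bil ev] if_False)
        (simp add: \<delta>2_formula_def neg1pow_def zero)
  qed
  then have "\<delta>2 A mul \<alpha> (G 1) x y z = 0" for x y z
    unfolding \<delta>2_def by (simp only: sum.neutral_const)
  with bil \<alpha>_G1 show ?thesis
    by (simp add: Z2_def C2_def)
qed

lemma equivalent_deformations_diff_in_B2:
  assumes G: "formal_deformation scale A mul \<alpha> G"
    and G': "formal_deformation scale A mul \<alpha> G'"
    and "equivalent_deformations scale \<alpha> G G'"
  shows "(\<lambda>x y. G 1 x y - G' 1 x y) \<in> B2 scale A mul \<alpha>"
proof -
  obtain \<phi> where lin: "Vector_Spaces.linear scale scale (\<phi> 1)" and \<phi>0: "\<phi> 0 = id"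
    and \<phi>\<alpha>: "formal_map \<phi> \<circ> fps_map \<alpha> = fps_map \<alpha> \<circ> formal_map \<phi>"
    and \<phi>G: "\<And>x y. formal_map \<phi> (formal_product G x y)
               = formal_product G' (formal_map \<phi> x) (formal_map \<phi> y)"
    using assms(3) unfolding equivalent_deformations_def by blast
  note D = formal_deformationD[OF G] and D' = formal_deformationD[OF G']
  note bil = D(1)[of 1] D'(1)[of 1] and ev = D(2)[of 1] D'(2)[of 1]
    and G0 = D(3) and G'0 = D'(3)
  note zero = bilin_eq_0[OF mul_bilin] bilin_eq_0[OF bil(1)] linear_eq_0[OF \<alpha>_linear]
    linear_eq_0[OF lin]
  \<comment> \<open>Since \<open>\<phi> 0\<close> is the identity, the constant terms entering the
    product of \<open>G'\<close> are those of the original arguments.\<close>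
  have nth0: "fps_nth (formal_map \<phi> x) 0 = fps_nth x 0" for x
    by (simp add: formal_map_def \<phi>0)
  have comm: "\<alpha> (\<phi> 1 x) = \<phi> 1 (\<alpha> x)" for x
    using arg_cong[OF fun_cong[OF \<phi>\<alpha>, of "fps_const x"], of "\<lambda>u. fps_nth u 1"]
    unfolding comp_def fps_nth_fps_map fps_nth_formal_map_1 by (simp add: \<phi>0 zero)
  \<comment> \<open>The coefficient of \<open>t\<close> in \<open>\<phi>G\<close> is
    \<open>G 1 x y + \<phi> 1 (x \<star> y)\<close> on the left and
    \<open>G' 1 x y + x \<star> \<phi> 1 y + \<phi> 1 x \<star> y\<close> on the right.\<close>
  have diff: "G 1 x y - G' 1 x y = x \<star> \<phi> 1 y + \<phi> 1 x \<star> y - \<phi> 1 (x \<star> y)" for x y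
    using arg_cong[OF \<phi>G[of "fps_const x" "fps_const y"], of "\<lambda>u. fps_nth u 1"]
    unfolding fps_nth_formal_map_1 fps_nth_formal_product_1 fps_nth_formal_product_0 nth0
    by (simp add: \<phi>0 G0 G'0 zero algebra_simps)
  have "homogeneous2 A 0 (\<lambda>x y. G 1 x y - G' 1 x y)"
    using ev subspace_diff[OF subspace_part] by (simp add: homogeneous2_def)
  from even_eq_\<delta>1_part1[OF bilin_diff[OF bil] this lin diff]
  have "(\<lambda>x y. G 1 x y - G' 1 x y) = \<delta>1 A mul (part1 A 0 (\<phi> 1))" .
  \<comment> \<open>Passing to the even part preserves compatibility with \<alpha>, because \<alpha>
    is even.\<close>
  moreover have "part1 A 0 (\<phi> 1) \<in> C1 scale \<alpha>"
    unfolding C1_def mem_Collect_eq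
    by (intro conjI allI linear_part1[OF lin] commute_part1[OF lin \<alpha>_linear \<alpha>_even] comm)
  ultimately show ?thesis
    unfolding B2_def by (rule image_eqI)
qed

end

theorem theorem4p8:
  fixes scale :: "'f::field \<Rightarrow> 'a::ab_group_add \<Rightarrow> 'a"
    and A :: "bit \<Rightarrow> 'a set"
    and mul :: "'a \<Rightarrow> 'a \<Rightarrow> 'a"
    and \<alpha> :: "'a \<Rightarrow> 'a"
    and G G' :: "nat \<Rightarrow> 'a \<Rightarrow> 'a \<Rightarrow> 'a"
  assumes "hom_novikov_superalgebra scale A mul \<alpha>"
    and "formal_deformation scale A mul \<alpha> G"
    and "formal_deformation scale A mul \<alpha> G'"
    and "equivalent_deformations scale \<alpha> G G'"
  shows "\<exists>c \<in> H2 scale A mul \<alpha>. G 1 \<in> c \<and> G' 1 \<in> c"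
proof -
  interpret hom_novikov_superalgebra scale A mul \<alpha> by fact
  let ?r = "{(f, g). f \<in> Z2 scale A mul \<alpha> \<and> g \<in> Z2 scale A mul \<alpha> \<and>
    (\<lambda>x y. f x y - g x y) \<in> B2 scale A mul \<alpha>}"
  have Z: "G 1 \<in> Z2 scale A mul \<alpha>" "G' 1 \<in> Z2 scale A mul \<alpha>"
    by (rule deformation_in_Z2[OF assms(2)], rule deformation_in_Z2[OF assms(3)])
  \<comment> \<open>The witness for \<open>c\<close> is the set of cocycles cohomologous to
    \<open>G 1\<close>, an element of the quotient because \<open>G 1\<close> is a cocycle.\<close>
  have "?r `` {G 1} \<in> H2 scale A mul \<alpha>"
    unfolding H2_def by (rule quotientI) (rule Z(1))
  moreover have "G 1 \<in> ?r `` {G 1}"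
    by (simp only: Image_singleton_iff mem_Collect_eq prod.case diff_self)
      (intro conjI Z zero_in_B2)
  moreover have "G' 1 \<in> ?r `` {G 1}"
    by (simp only: Image_singleton_iff mem_Collect_eq prod.case)
      (intro conjI Z equivalent_deformations_diff_in_B2[OF assms(2-4)])
  ultimately show ?thesis by (intro bexI conjI)
qed

end
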